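(* Let $\mu>1$ and let $n\ge 3$ be an integer. Then the functions $\varphi^{(n,m)}$, $m\in\mathbb{Z}_+$, satisfy the convolution property $$\varphi^{(n,0)} = B^{(0,1)} * \varphi^{(n-1,0)},\qquad \varphi^{(n,m)} = B^{(0,m)} * \varphi^{(n-1,m)}\quad (m>0).$$
   Context: $\mathbb{Z}_+=\{0,1,2,\dots\}$; the Fourier transform is $\widehat f(\omega)=\int_{\mathbb{R}} f(x)e^{-i\omega x}\,dx$; $*$ is convolution on $\mathbb{R}$. Masks: fix a real parameter $\mu>1$. For an integer $n\ge 2$, let $a^{(n,0)}_0=a^{(n,0)}_1=\tfrac12$ and $a^{(n,0)}_\alpha=0$ otherwise; for $m\ge 1$ let $$a^{(n,m)}_\alpha=\frac{1}{2^{n+1+m^{-\mu}}}\left[\binom{n+1}{\alpha}+4\bigl(2^{m^{-\mu}}-1\bigr)\binom{n-1}{\alpha-1}\right],\quad 0\le\alpha\le n+1,$$ and $a^{(n,m)}_\alpha=0$ otherwise (with $\binom{p}{q}=0$ if $q<0$ or $q>p$). The symbols are $A^{(n,m)}(z)=\sum_\alpha a^{(n,m)}_\alpha z^\alpha$. Refinable functions: for $m\in\mathbb{Z}_+$, $\varphi^{(n,m)}\in L_2(\mathbb{R})$ is the compactly supported function with $\widehat{\varphi}^{(n,m)}(\omega)=\prod_{k=m}^{\infty}A^{(n,k)}\bigl(e^{-i\omega/2^{k+1}}\bigr)$, so that $\widehat\varphi^{(n,m)}(0)=1$ and $\varphi^{(n,m)}=\sum_\alpha a^{(n,m)}_\alpha\,\varphi^{(n,m+1)}(\cdot-2^{-(m+1)}\alpha)$.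 B-splines: $B^{(n,m)}$ is the B-spline of degree $n\ge0$ with knots on $2^{-m}\mathbb{Z}$, normalized so that $\widehat B^{(n,m)}(0)=1$, i.e. $\widehat B^{(n,m)}(\omega)=\left(\frac{1-e^{-i\omega/2^m}}{i\omega 2^{-m}}\right)^{n+1}$. In particular $B^{(0,m)}=2^m\chi_{[0,2^{-m}]}$. *)

theory Defs
  imports "HOL-Analysis.Analysis"
begin

definition fourier :: "(real \<Rightarrow> complex) \<Rightarrow> real \<Rightarrow> complex" where
  "fourier f \<omega> = (\<integral>x. f x * exp (- (\<i> * of_real (\<omega> * x))) \<partial>lborel)"

definition convol :: "(real \<Rightarrow> complex) \<Rightarrow> (real \<Rightarrow> complex) \<Rightarrow> real \<Rightarrow> complex" where
  "convol f g x = (\<integral>t. f t * g (x - t) \<partial>lborel)"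

text \<open>
  The masks vanish for negative indices, so they are indexed by natural numbers. The case
  distinction on \<open>\<alpha> = 0\<close> is needed since subtraction is truncated; the binomial coefficients
  with lower entry exceeding the upper one are zero by definition of \<open>choose\<close>.
\<close>

definition mask :: "real \<Rightarrow> nat \<Rightarrow> nat \<Rightarrow> nat \<Rightarrow> real" where
  "mask \<mu> n m \<alpha> =
     (if m = 0 then (if \<alpha> \<le> 1 then 1 / 2 else 0)
      else if \<alpha> \<le> n + 1 then
        1 / 2 powr (real n + 1 + real m powr (- \<mu>)) *
          (real ((n + 1) choose \<alpha>) +
           4 * (2 powr (real m powr (- \<mu>)) - 1) *
             (if \<alpha> = 0 then 0 else real ((n - 1) choose (\<alpha> - 1))))
      else 0)"

text \<open>All masks are supported in \<open>{0..n + 1}\<close>, so the sum below runs over the whole support.\<close>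

definition symb :: "real \<Rightarrow> nat \<Rightarrow> nat \<Rightarrow> complex \<Rightarrow> complex" where
  "symb \<mu> n m z = (\<Sum>\<alpha>\<le>n + 1. of_real (mask \<mu> n m \<alpha>) * z ^ \<alpha>)"

definition square_integrable :: "(real \<Rightarrow> complex) \<Rightarrow> bool" where
  "square_integrable f \<longleftrightarrow>
     f \<in> borel_measurable lborel \<and> integrable lborel (\<lambda>x. (norm (f x))\<^sup>2)"

definition compactly_supported :: "(real \<Rightarrow> complex) \<Rightarrow> bool" where
  "compactly_supported f \<longleftrightarrow> (\<exists>K. compact K \<and> (AE x in lborel. x \<notin> K \<longrightarrow> f x = 0))"

text \<open>
  The function of index \<open>(n, m)\<close> is an element of \<open>L\<^sub>2\<close>, hence determined only up to a null
  set; this predicate singles out its representatives. The infinite product over indices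
  \<open>\<ge> m\<close> is shifted to start at 0; finitely many of its factors may vanish.
\<close>

definition refinable_function :: "real \<Rightarrow> nat \<Rightarrow> nat \<Rightarrow> (real \<Rightarrow> complex) \<Rightarrow> bool" where
  "refinable_function \<mu> n m f \<longleftrightarrow>
     square_integrable f \<and> compactly_supported f \<and>
     (\<forall>\<omega>. fourier f \<omega> =
        (\<Prod>k. symb \<mu> n (m + k) (exp (- (\<i> * of_real (\<omega> / 2 ^ (m + k + 1)))))))"

text \<open>
  The B-spline of degree \<open>n\<close> with knots on \<open>2\<^sup>-\<^sup>m \<int>\<close> and integral 1, as the \<open>(n + 1)\<close>-fold
  convolution power of the normalised indicator function of \<open>[0, 2\<^sup>-\<^sup>m]\<close>; its Fourier transform
  is the \<open>(n + 1)\<close>-st power of that of the latter.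
\<close>

fun bspline :: "nat \<Rightarrow> nat \<Rightarrow> real \<Rightarrow> complex" where
  "bspline 0 m = (\<lambda>x. 2 ^ m * indicator {0..1 / 2 ^ m} x)"
| "bspline (Suc n) m = convol (bspline 0 m) (bspline n m)"

end

theory Submission
  imports Defs "HOL-Probability.Levy"
begin

text \<open>
  Raising the degree by one multiplies every symbol of positive level by \<open>(1 + z) / 2\<close>
  (\<open>symb_Suc\<close>): both terms of the mask of level \<open>m\<close> have generating functions divisible by
  \<open>(1 + z) ^ (n - 1)\<close>, and \<open>n\<close> enters otherwise only through the factor \<open>1 / 2 ^ n\<close>. The symbol
  of level 0 is the same for all degrees.

  With \<open>z = exp (- \<i> \<omega> / 2 ^ (m + 1))\<close>, multiplication by \<open>(1 + z) / 2\<close> turns the Fourier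
  transform at \<open>\<omega>\<close> of the box function of level \<open>m + 1\<close> into that of level \<open>m\<close>
  (\<open>fourier_box_two_scale\<close>). The product of these factors over all levels from \<open>m\<close> on
  telescopes, and the transforms of
  the boxes tend to 1, so for \<open>m > 0\<close> the infinite products for the degrees \<open>n\<close> and \<open>n - 1\<close>
  differ exactly by a factor, the Fourier transform of the box of level \<open>m\<close>. For \<open>m = 0\<close> the factor of
  level 0 is common to both products, so telescoping starts at level 1; this is why the
  box has level 1 there, and why \<open>max m 1\<close> appears below (\<open>prodinf_symb_Suc\<close>).

  It remains to return to functions. The refinable functions are integrable, being square
  integrable with compact support; convolution becomes a product under the Fourier transform
  (\<open>fourier_convol\<close>); and an integrable function is determined almost everywhere by its Fourier
  transform (\<open>fourier_eq_imp_AE_eq\<close>), which is Levy's uniqueness theorem for characteristic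
  functions in disguise.
\<close>

section \<open>Uniqueness of Fourier transforms of integrable functions\<close>

lemma measurable_fourier_kernel [measurable]:
  "(\<lambda>x. exp (- (\<i> * of_real (\<omega> * x)))) \<in> borel_measurable borel"
  by (intro borel_measurable_continuous_onI continuous_intros)

lemma integrable_mult_fourier_kernel:
  assumes "integrable lborel f"
  shows "integrable lborel (\<lambda>x. f x * exp (- (\<i> * of_real (\<omega> * x))))"
proof (rule Bochner_Integration.integrable_bound[OF assms])
  show "(\<lambda>x. f x * exp (- (\<i> * of_real (\<omega> * x)))) \<in> borel_measurable lborel"
    using assms by measurable
qed (simp add: norm_mult)

text \<open>
  The positive and the negative part of \<open>u\<close> have the same Fourier transform, in particular the
  same integral. Unless that integral is 0, normalising both parts gives two probability
  densities with equal characteristic functions, hence with equal distributions.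
\<close>

lemma real_AE_zero_if_fourier_zero:
  fixes u :: "real \<Rightarrow> real"
  assumes int: "integrable lborel u"
    and zero: "\<And>\<omega>. (\<integral>x. u x *\<^sub>R iexp (\<omega> * x) \<partial>lborel) = 0"
  shows "AE x in lborel. u x = 0"
proof -
  define p where "p x = max 0 (u x)" for x
  define q where "q x = max 0 (- u x)" for x
  have u_eq: "u x = p x - q x" for x by (simp add: p_def q_def)
  have p0: "p x \<ge> 0" and q0: "q x \<ge> 0" for x by (simp_all add: p_def q_def)
  have ip: "integrable lborel p" and iq: "integrable lborel q"
    unfolding p_def q_def using int by auto
  have mp [measurable]: "p \<in> borel_measurable borel" and mq [measurable]: "q \<in> borel_measurable borel"
    using ip iq by auto
  have iexp_int: "integrable lborel (\<lambda>x. r x *\<^sub>R iexp (\<omega> * x))"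
    if "integrable lborel r" for r :: "real \<Rightarrow> real" and \<omega>
    by (rule Bochner_Integration.integrable_bound[OF that])
      (use that in \<open>auto simp: intro!: borel_measurable_scaleR borel_measurable_continuous_onI continuous_intros\<close>)
  have eq: "(\<integral>x. p x *\<^sub>R iexp (\<omega> * x) \<partial>lborel) = (\<integral>x. q x *\<^sub>R iexp (\<omega> * x) \<partial>lborel)" for \<omega>
    using zero[of \<omega>] iexp_int[OF ip, of \<omega>] iexp_int[OF iq, of \<omega>]
    by (simp add: u_eq scaleR_diff_left)
  define c where "c = (\<integral>x. p x \<partial>lborel)"
  have cq: "c = (\<integral>x. q x \<partial>lborel)"
  proof -
    have "complex_of_real (\<integral>x. p x \<partial>lborel) = of_real (\<integral>x. q x \<partial>lborel)"
      unfolding integral_complex_of_real[symmetric]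
      using eq[of 0] by (simp add: scaleR_conv_of_real del: integral_complex_of_real)
    then show ?thesis unfolding c_def of_real_eq_iff .
  qed
  have c0: "c \<ge> 0" unfolding c_def by (intro integral_nonneg_AE) (simp add: p0)
  show ?thesis
  proof (cases "c = 0")
    case True
    have "AE x in lborel. p x = 0"
      using integral_nonneg_eq_0_iff_AE[OF ip] True p0 by (simp add: c_def)
    moreover have "AE x in lborel. q x = 0"
      using integral_nonneg_eq_0_iff_AE[OF iq] True q0 by (simp add: cq)
    ultimately show ?thesis by eventually_elim (simp add: u_eq)
  next
    case False
    with c0 have c: "c > 0" by simp
    define M where "M r = density lborel (\<lambda>x. ennreal (r x / c))" for r :: "real \<Rightarrow> real"
    have M: "real_distribution (M r)"
      if r: "integrable lborel r" "\<And>x. r x \<ge> 0" "(\<integral>x. r x \<partial>lborel) = c" for r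
    proof -
      have "(\<integral>\<^sup>+x. ennreal (r x / c) \<partial>lborel) = ennreal (\<integral>x. r x / c \<partial>lborel)"
        using r c by (intro nn_integral_eq_integral) auto
      also have "\<dots> = 1" using r c by simp
      finally have "(\<integral>\<^sup>+x. ennreal (r x / c) \<partial>lborel) = 1" .
      moreover have "r \<in> borel_measurable borel" using r by auto
      ultimately have "prob_space (M r)"
        by (intro prob_spaceI) (simp add: M_def emeasure_density)
      then show ?thesis
        by (simp add: real_distribution_def real_distribution_axioms_def M_def)
    qed
    have charM: "char (M r) \<omega> = (\<integral>x. r x *\<^sub>R iexp (\<omega> * x) \<partial>lborel) / c"
      if r: "integrable lborel r" "\<And>x. r x \<ge> 0" for r \<omega>
    proof -
      have [measurable]: "r \<in> borel_measurable borel" using r by auto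
      have "char (M r) \<omega> = (\<integral>x. (r x / c) *\<^sub>R iexp (\<omega> * x) \<partial>lborel)"
        unfolding char_def M_def using r(2) c
        by (subst integral_density)
          (auto intro!: borel_measurable_continuous_onI continuous_intros)
      also have "\<dots> = (\<integral>x. (r x *\<^sub>R iexp (\<omega> * x)) / c \<partial>lborel)"
        by (intro Bochner_Integration.integral_cong) (auto simp: scaleR_conv_of_real)
      finally show ?thesis by simp
    qed
    have "char (M p) = char (M q)"
      by (rule ext) (simp only: charM[OF ip p0] charM[OF iq q0] eq)
    then have "M p = M q"
      by (rule Levy_uniqueness[OF M[OF ip p0 c_def[symmetric]] M[OF iq q0 cq[symmetric]]])
    then have "AE x in lborel. ennreal (p x / c) = ennreal (q x / c)"
      unfolding M_def by (subst (asm) sigma_finite_measure.density_unique_iff[OF sigma_finite_lborel]) auto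
    then show ?thesis
      by eventually_elim (use c p0 q0 in \<open>auto simp: u_eq\<close>)
  qed
qed

text \<open>
  The transform of the complex conjugate of \<open>f\<close> at \<open>\<omega>\<close> is the conjugate of the transform of \<open>f\<close>
  at \<open>- \<omega>\<close>, so the transform of the real part vanishes too and the real case applies.
\<close>

lemma fourier_zero_imp_AE_Re_zero:
  assumes int: "integrable lborel f" and zero: "\<And>\<omega>. fourier f \<omega> = 0"
  shows "AE x in lborel. Re (f x) = 0"
proof (rule real_AE_zero_if_fourier_zero)
  show "integrable lborel (\<lambda>x. Re (f x))" using int by simp
  fix \<omega>
  note i = integrable_mult_fourier_kernel[OF int]
  have "(\<integral>x. Re (f x) *\<^sub>R iexp (\<omega> * x) \<partial>lborel) =
     (\<integral>x. (f x * exp (- (\<i> * of_real (- \<omega> * x))) + cnj (f x * exp (- (\<i> * of_real (\<omega> * x))))) / 2 \<partial>lborel)"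
    by (intro Bochner_Integration.integral_cong refl)
       (simp add: exp_cnj complex_add_cnj flip: distrib_right, simp add: scaleR_conv_of_real)
  also have "\<dots> = (fourier f (- \<omega>) + cnj (fourier f \<omega>)) / 2"
    unfolding fourier_def integral_divide_zero
      Bochner_Integration.integral_add[OF i complex_integrable_cnj[THEN iffD2, OF i]]
      Bochner_Integration.integral_cnj ..
  finally show "(\<integral>x. Re (f x) *\<^sub>R iexp (\<omega> * x) \<partial>lborel) = 0" by (simp add: zero)
qed

lemma fourier_eq_imp_AE_eq:
  assumes f: "integrable lborel f" and g: "integrable lborel g"
    and eq: "\<And>\<omega>. fourier f \<omega> = fourier g \<omega>"
  shows "AE x in lborel. f x = g x"
proof -
  define d where "d x = f x - g x" for x
  have d: "integrable lborel d" unfolding d_def using f g by simp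
  have dz: "fourier d \<omega> = 0" for \<omega>
    using eq[of \<omega>] integrable_mult_fourier_kernel[OF f, of \<omega>] integrable_mult_fourier_kernel[OF g, of \<omega>]
    by (simp add: fourier_def d_def left_diff_distrib)
  \<comment> \<open>The imaginary part of \<open>d\<close> is, up to sign, the real part of \<open>\<i> * d\<close>.\<close>
  have "fourier (\<lambda>x. \<i> * d x) \<omega> = 0" for \<omega>
    using dz[of \<omega>] by (simp add: fourier_def mult.assoc)
  then have "AE x in lborel. Re (\<i> * d x) = 0"
    by (intro fourier_zero_imp_AE_Re_zero) (use d in auto)
  moreover have "AE x in lborel. Re (d x) = 0"
    by (rule fourier_zero_imp_AE_Re_zero[OF d dz])
  ultimately show ?thesis
    by eventually_elim (simp add: d_def complex_eq_iff)
qed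

section \<open>The convolution theorem\<close>

lemma integrable_convol_kernel:
  fixes f g :: "real \<Rightarrow> complex"
  assumes f: "integrable lborel f" and g: "integrable lborel g"
  shows "integrable (lborel \<Otimes>\<^sub>M lborel) (\<lambda>(t, x). f t * g (x - t))"
proof (rule lborel_pair.Fubini_integrable)
  have [measurable]: "f \<in> borel_measurable borel" "g \<in> borel_measurable borel" using f g by auto
  show "(\<lambda>(t, x). f t * g (x - t)) \<in> borel_measurable (lborel \<Otimes>\<^sub>M lborel)" by measurable
  have shift: "integrable lborel (\<lambda>x. g (x - t))" for t
    using lborel_integrable_real_affine[OF g, of 1 "-t"] by simp
  then show "AE t in lborel. integrable lborel (\<lambda>x. case (t, x) of (t, x) \<Rightarrow> f t * g (x - t))"
    by simp
  have "(\<integral>x. norm (g (x - t)) \<partial>lborel) = (\<integral>x. norm (g x) \<partial>lborel)" for t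
    using lborel_integral_real_affine[of 1 "\<lambda>x. norm (g x)" "-t"] by simp
  then show "integrable lborel (\<lambda>t. \<integral>x. norm (case (t, x) of (t, x) \<Rightarrow> f t * g (x - t)) \<partial>lborel)"
    using f by (simp add: norm_mult)
qed

lemma integrable_convol:
  assumes "integrable lborel f" and "integrable lborel g"
  shows "integrable lborel (convol f g)"
proof -
  have "integrable (lborel \<Otimes>\<^sub>M lborel) (\<lambda>(x, t). f t * g (x - t))"
    using lborel_pair.integrable_product_swap[OF integrable_convol_kernel[OF assms]] by simp
  from lborel_pair.integrable_fst'[OF this] show ?thesis
    by (simp add: convol_def[abs_def])
qed

lemma fourier_convol:
  assumes f: "integrable lborel f" and g: "integrable lborel g"
  shows "fourier (convol f g) \<omega> = fourier f \<omega> * fourier g \<omega>"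
proof -
  define e where "e x = exp (- (\<i> * of_real (\<omega> * x)))" for x :: real
  have e_add: "e (x + y) = e x * e y" for x y
    by (simp add: e_def algebra_simps flip: exp_add)
  have fe: "integrable lborel (\<lambda>x. f x * e x)" and ge: "integrable lborel (\<lambda>x. g x * e x)"
    unfolding e_def by (intro integrable_mult_fourier_kernel f g)+
  \<comment> \<open>Multiplying both factors by the character turns the kernel into itself times \<open>e x\<close>.\<close>
  have kernel: "(f t * e t) * (g (x - t) * e (x - t)) = f t * g (x - t) * e x" for t x
    using e_add[of t "x - t"] by simp
  have int: "integrable (lborel \<Otimes>\<^sub>M lborel) (\<lambda>(t, x). f t * g (x - t) * e x)"
    using integrable_convol_kernel[OF fe ge] by (simp add: kernel)
  have "fourier (convol f g) \<omega> = (\<integral>x. (\<integral>t. f t * g (x - t) * e x \<partial>lborel) \<partial>lborel)"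
    by (simp add: fourier_def convol_def e_def)
  also have "\<dots> = (\<integral>t. (\<integral>x. f t * g (x - t) * e x \<partial>lborel) \<partial>lborel)"
    using lborel_pair.Fubini_integral[OF int] by simp
  also have "\<dots> = (\<integral>t. f t * e t * (\<integral>x. g (x - t) * e (x - t) \<partial>lborel) \<partial>lborel)"
  proof (intro Bochner_Integration.integral_cong refl)
    fix t :: real
    show "(\<integral>x. f t * g (x - t) * e x \<partial>lborel) = f t * e t * (\<integral>x. g (x - t) * e (x - t) \<partial>lborel)"
      unfolding integral_mult_right_zero[symmetric] kernel ..
  qed
  also have "(\<lambda>t. (\<integral>x. g (x - t) * e (x - t) \<partial>lborel)) = (\<lambda>t. fourier g \<omega>)"
    using lborel_integral_real_affine[of 1 "\<lambda>x. g x * e x" "- _"] by (simp add: fourier_def e_def)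
  finally show ?thesis by (simp add: fourier_def e_def)
qed

text \<open>
  On the support, \<open>norm (f x) \<le> 1 + (norm (f x))\<^sup>2\<close>, and both terms are integrable there
  because a compact set has finite measure.
\<close>

lemma square_integrable_compactly_supported_imp_integrable:
  assumes sq: "square_integrable f" and supp: "compactly_supported f"
  shows "integrable lborel f"
proof -
  obtain K where K: "compact K" "AE x in lborel. x \<notin> K \<longrightarrow> f x = 0"
    using supp by (auto simp: compactly_supported_def)
  have "integrable lborel (\<lambda>x. indicator K x + (norm (f x))\<^sup>2 :: real)"
    using sq borel_compact[OF K(1)] emeasure_compact_finite[OF K(1)]
    by (auto simp: square_integrable_def intro!: Bochner_Integration.integrable_add integrable_real_indicator)
  then show ?thesis
  proof (rule Bochner_Integration.integrable_bound)
    show "f \<in> borel_measurable lborel" using sq by (simp add: square_integrable_def)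
    show "AE x in lborel. norm (f x) \<le> norm (indicator K x + (norm (f x))\<^sup>2 :: real)"
      using K(2)
    proof eventually_elim
      case (elim x)
      have "norm (f x) \<le> 1 + (norm (f x))\<^sup>2"
        using zero_le_power2[of "norm (f x) - 1"] by (simp add: power2_diff) (smt (verit) norm_ge_zero)
      with elim show ?case by (cases "x \<in> K") auto
    qed
  qed
qed

section \<open>The Fourier transform of the box function\<close>

lemma has_bochner_integral_box:
  "\<omega> \<noteq> 0 \<Longrightarrow> has_bochner_integral lborel (\<lambda>x. bspline 0 m x * exp (- (\<i> * of_real (\<omega> * x))))
     ((1 - exp (- (\<i> * of_real (\<omega> / 2 ^ m)))) / (\<i> * of_real (\<omega> / 2 ^ m)))"
proof -
  assume w: "\<omega> \<noteq> 0"
  define F where "F x = - (2 ^ m * exp (- (\<i> * of_real (\<omega> * x))) / (\<i> * of_real \<omega>))" for x :: real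
  have "has_bochner_integral lborel
     (\<lambda>x. indicator {0..1 / 2 ^ m} x *\<^sub>R (2 ^ m * exp (- (\<i> * of_real (\<omega> * x))))) (F (1 / 2 ^ m) - F 0)"
  proof (rule has_bochner_integral_FTC_Icc)
    fix x :: real
    have "((\<lambda>z. - (2 ^ m * exp (- (\<i> * (of_real \<omega> * z))) / (\<i> * of_real \<omega>))) has_field_derivative
        2 ^ m * exp (- (\<i> * (of_real \<omega> * of_real x)))) (at (of_real x))"
      using w by (auto intro!: derivative_eq_intros simp: field_simps)
    from has_vector_derivative_real_field[OF this]
    show "(F has_vector_derivative 2 ^ m * exp (- (\<i> * of_real (\<omega> * x)))) (at x within {0..1/2^m})"
      by (simp only: F_def[abs_def] of_real_mult)
  qed (auto intro!: continuous_intros)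
  moreover have "F (1 / 2 ^ m) - F 0 =
      (1 - exp (- (\<i> * of_real (\<omega> / 2 ^ m)))) / (\<i> * of_real (\<omega> / 2 ^ m))"
    using w by (simp add: F_def field_simps)
  moreover have "(\<lambda>x. indicator {0..1 / 2 ^ m} x *\<^sub>R (2 ^ m * exp (- (\<i> * of_real (\<omega> * x))))) =
      (\<lambda>x. bspline 0 m x * exp (- (\<i> * of_real (\<omega> * x))))"
    by (auto simp: indicator_def)
  ultimately show ?thesis by simp
qed

lemma fourier_box:
  assumes "\<omega> \<noteq> 0"
  shows "fourier (bspline 0 m) \<omega> =
     (1 - exp (- (\<i> * of_real (\<omega> / 2 ^ m)))) / (\<i> * of_real (\<omega> / 2 ^ m))"
  unfolding fourier_def
  by (rule has_bochner_integral_integral_eq[OF has_bochner_integral_box[OF assms]])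

lemma box_eq_of_real: "bspline 0 m = (\<lambda>x. of_real (2 ^ m * indicator {0..1 / 2 ^ m} x))"
  by (auto simp: indicator_def)

lemma integrable_box: "integrable lborel (bspline 0 m)"
  unfolding box_eq_of_real
  by (intro integrable_of_real integrable_mult_right integrable_real_indicator) auto

lemma fourier_box_0: "fourier (bspline 0 m) 0 = 1"
proof -
  have "fourier (bspline 0 m) 0 = (\<integral>x. of_real (2 ^ m * indicator {0..1 / 2 ^ m :: real} x) \<partial>lborel)"
    unfolding fourier_def box_eq_of_real by simp
  also have "\<dots> = 1" by (subst integral_complex_of_real) simp
  finally show ?thesis .
qed

text \<open>
  For \<open>\<omega> \<noteq> 0\<close>, with \<open>w = exp (- \<i> \<omega> / 2 ^ (m + 1))\<close>, this is the factorisation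
  \<open>1 - w\<^sup>2 = (1 + w) (1 - w)\<close> of the numerator in the closed form.
\<close>

lemma fourier_box_two_scale:
  "fourier (bspline 0 m) \<omega> =
     (1 + exp (- (\<i> * of_real (\<omega> / 2 ^ (m + 1))))) / 2 * fourier (bspline 0 (m + 1)) \<omega>"
proof (cases "\<omega> = 0")
  case False
  define w where "w = exp (- (\<i> * of_real (\<omega> / 2 ^ (m + 1))))"
  have "exp (- (\<i> * of_real (\<omega> / 2 ^ m))) = w * w"
    unfolding w_def by (simp add: field_simps flip: exp_add)
  then show ?thesis
    using False unfolding fourier_box[OF False] w_def[symmetric] by (simp add: field_simps)
qed (simp add: fourier_box_0 del: bspline.simps)

text \<open>
  The closed form is a difference quotient of \<open>exp\<close> at 0 with increment \<open>- \<i> \<omega> / 2 ^ m\<close>.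
\<close>

lemma tendsto_fourier_box: "(\<lambda>m. fourier (bspline 0 m) \<omega>) \<longlonglongrightarrow> 1"
proof (cases "\<omega> = 0")
  case False
  have "((\<lambda>h::complex. (exp h - 1) / h) \<longlongrightarrow> 1) (at 0)"
    using DERIV_exp[of "0::complex"] by (simp add: DERIV_def)
  moreover have "filterlim (\<lambda>m. - (\<i> * of_real (\<omega> / 2 ^ m))) (at 0) sequentially"
  proof -
    have "(\<lambda>m. \<omega> / 2 ^ m) \<longlonglongrightarrow> 0"
      by (rule LIMSEQ_divide_realpow_zero) simp
    then have "(\<lambda>m. - (\<i> * of_real (\<omega> / 2 ^ m))) \<longlonglongrightarrow> - (\<i> * of_real 0)"
      by (intro tendsto_intros)
    with False show ?thesis by (simp add: filterlim_at)
  qed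
  ultimately have "(\<lambda>m. (exp (- (\<i> * of_real (\<omega> / 2 ^ m))) - 1) / - (\<i> * of_real (\<omega> / 2 ^ m))) \<longlonglongrightarrow> 1"
    by (rule filterlim_compose)
  moreover have "(a - 1) / - b = (1 - a) / b" for a b :: complex
    by (cases "b = 0") (auto simp: field_simps)
  ultimately show ?thesis
    unfolding fourier_box[OF False] by (simp only:)
qed (simp add: fourier_box_0 del: bspline.simps)

section \<open>The symbols\<close>

lemma symb_0: "symb \<mu> n 0 z = (1 + z) / 2"
proof -
  have "symb \<mu> n 0 z = (\<Sum>\<alpha>\<in>{0, 1}. of_real (mask \<mu> n 0 \<alpha>) * z ^ \<alpha>)"
    unfolding symb_def by (rule sum.mono_neutral_right) (auto simp: mask_def)
  then show ?thesis by (simp add: mask_def field_simps)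
qed

lemma sum_shifted_binomial:
  fixes z :: complex
  assumes "n \<ge> 1"
  shows "(\<Sum>\<alpha>\<le>n + 1. (if \<alpha> = 0 then 0 else of_nat ((n - 1) choose (\<alpha> - 1))) * z ^ \<alpha>) = z * (1 + z) ^ (n - 1)"
proof -
  obtain k where n: "n = Suc k" using assms by (cases n) auto
  have "(1 + z) ^ k = (\<Sum>\<alpha>\<le>k. of_nat (k choose \<alpha>) * z ^ \<alpha>)"
    using binomial_ring[of z 1 k] by (simp add: add.commute)
  then have "z * (1 + z) ^ k = (\<Sum>\<alpha>\<le>Suc k. of_nat (k choose \<alpha>) * z ^ Suc \<alpha>)"
    by (simp add: sum_distrib_left mult_ac binomial_eq_0)
  then show ?thesis
    unfolding n add_Suc_right add_0_right One_nat_def sum.atMost_Suc_shift[of _ "Suc k"] by simp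
qed

lemma symb_closed_form:
  fixes \<mu> :: real
  assumes n: "n \<ge> 1" and m: "m \<ge> 1"
  defines "\<epsilon> \<equiv> real m powr (- \<mu>)"
  shows "symb \<mu> n m z = of_real (1 / 2 powr (real n + 1 + \<epsilon>)) *
     ((1 + z) ^ (n + 1) + of_real (4 * (2 powr \<epsilon> - 1)) * (z * (1 + z) ^ (n - 1)))"
proof -
  have "symb \<mu> n m z = of_real (1 / 2 powr (real n + 1 + \<epsilon>)) *
      ((\<Sum>\<alpha>\<le>n + 1. of_nat ((n + 1) choose \<alpha>) * z ^ \<alpha>) + of_real (4 * (2 powr \<epsilon> - 1)) *
       (\<Sum>\<alpha>\<le>n + 1. (if \<alpha> = 0 then 0 else of_nat ((n - 1) choose (\<alpha> - 1))) * z ^ \<alpha>))"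
    unfolding symb_def sum_distrib_left sum.distrib[symmetric]
    by (rule sum.cong) (use m in \<open>auto simp: mask_def \<epsilon>_def algebra_simps\<close>)
  also have "(\<Sum>\<alpha>\<le>n + 1. of_nat ((n + 1) choose \<alpha>) * z ^ \<alpha>) = (1 + z) ^ (n + 1)"
    using binomial_ring[of z 1 "n + 1"] by (simp add: add.commute)
  finally show ?thesis unfolding sum_shifted_binomial[OF n] .
qed

text \<open>
  In the closed form, \<open>n \<mapsto> n + 1\<close> gives one more factor \<open>1 + z\<close> in each term of the bracket
  and halves the constant in front. The condition \<open>n \<ge> 1\<close> keeps the exponent \<open>n - 1\<close> from being
  truncated.
\<close>

lemma symb_Suc:
  assumes "n \<ge> 1" and "m \<ge> 1"
  shows "symb \<mu> (Suc n) m z = (1 + z) / 2 * symb \<mu> n m z"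
proof -
  obtain k where n: "n = Suc k" using assms(1) by (cases n) auto
  define \<epsilon> where "\<epsilon> = real m powr (- \<mu>)"
  define b :: complex where "b = of_real (4 * (2 powr \<epsilon> - 1))"
  have "2 powr (real (Suc n) + 1 + \<epsilon>) = 2 * 2 powr (real n + 1 + \<epsilon>)"
    by (simp add: powr_add)
  then have half: "complex_of_real (1 / 2 powr (real (Suc n) + 1 + \<epsilon>)) =
      of_real (1 / 2 powr (real n + 1 + \<epsilon>)) / 2" by simp
  have alg: "(1 + z) ^ (Suc n + 1) + b * (z * (1 + z) ^ (Suc n - 1)) =
      (1 + z) * ((1 + z) ^ (n + 1) + b * (z * (1 + z) ^ (n - 1)))"
    by (simp add: n algebra_simps)
  have "Suc n \<ge> 1" by simp
  show ?thesis
    unfolding symb_closed_form[OF \<open>Suc n \<ge> 1\<close> assms(2)] symb_closed_form[OF assms]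
    unfolding \<epsilon>_def[symmetric] b_def[symmetric] half alg by (simp only: times_divide_eq_left times_divide_eq_right mult_ac)
qed

text \<open>
  The correction term of the mask is chosen for this: with \<open>\<epsilon> = m powr (- \<mu>)\<close>, the bracket at
  \<open>z = 1\<close> equals \<open>2 ^ (n + 1) * (1 + (2 powr \<epsilon> - 1))\<close>, which cancels the constant in front.
\<close>

lemma symb_1: "n \<ge> 1 \<Longrightarrow> symb \<mu> n m 1 = 1"
proof (cases "m = 0")
  case False
  assume n: "n \<ge> 1"
  define \<epsilon> where "\<epsilon> = real m powr (- \<mu>)"
  obtain k where k: "n = Suc k" using n by (cases n) auto
  have "2 ^ (n + 1) + 4 * (2 powr \<epsilon> - 1) * 2 ^ (n - 1) = 2 powr (real n + 1 + \<epsilon>)"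
    by (simp add: k powr_add powr_realpow field_simps)
  then have "complex_of_real (2 ^ (n + 1) + 4 * (2 powr \<epsilon> - 1) * 2 ^ (n - 1)) = of_real (2 powr (real n + 1 + \<epsilon>))"
    by simp
  then have "2 ^ (n + 1) + of_real (4 * (2 powr \<epsilon> - 1)) * 2 ^ (n - 1) = complex_of_real (2 powr (real n + 1 + \<epsilon>))"
    by simp
  then show ?thesis
    using n False by (simp add: symb_closed_form \<epsilon>_def)
qed (simp add: symb_0)

lemma mask_nonneg: "mask \<mu> n m \<alpha> \<ge> 0"
proof -
  have "1 \<le> 2 powr (real m powr (- \<mu>))"
    by (rule ge_one_powr_ge_zero) auto
  then show ?thesis unfolding mask_def by simp
qed

text \<open>
  The masks are nonnegative with sum 1, so \<open>symb \<mu> n m z - 1\<close> is a weighted mean of the numbers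
  \<open>z ^ \<alpha> - 1\<close> with \<open>\<alpha> \<le> n + 1\<close>. It is crucial that the bound does not depend on the level.
\<close>

lemma norm_symb_minus_1_le:
  assumes n: "n \<ge> 1" and z: "norm z \<le> 1"
  shows "norm (symb \<mu> n m z - 1) \<le> (real n + 1) * norm (z - 1)"
proof -
  have s: "(\<Sum>\<alpha>\<le>n + 1. mask \<mu> n m \<alpha>) = 1"
  proof -
    have "complex_of_real (\<Sum>\<alpha>\<le>n + 1. mask \<mu> n m \<alpha>) = 1"
      using symb_1[OF n, of \<mu> m] by (simp add: symb_def)
    then show ?thesis using of_real_eq_1_iff by blast
  qed
  have "symb \<mu> n m z - 1 = symb \<mu> n m z - symb \<mu> n m 1" using symb_1[OF n] by simp
  also have "\<dots> = (\<Sum>\<alpha>\<le>n + 1. of_real (mask \<mu> n m \<alpha>) * (z ^ \<alpha> - 1 ^ \<alpha>))"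
    unfolding symb_def by (simp add: algebra_simps sum_subtractf)
  also have "norm \<dots> \<le> (\<Sum>\<alpha>\<le>n + 1. mask \<mu> n m \<alpha> * ((real n + 1) * norm (z - 1)))"
  proof (rule sum_norm_le)
    fix \<alpha> assume "\<alpha> \<in> {..n + 1}"
    then have "real \<alpha> * norm (z - 1) \<le> (real n + 1) * norm (z - 1)"
      by (intro mult_right_mono) auto
    with norm_power_diff[OF z, of 1 \<alpha>]
    have "norm (z ^ \<alpha> - 1 ^ \<alpha>) \<le> (real n + 1) * norm (z - 1)" by simp
    then show "norm (of_real (mask \<mu> n m \<alpha>) * (z ^ \<alpha> - 1 ^ \<alpha>)) \<le> mask \<mu> n m \<alpha> * ((real n + 1) * norm (z - 1))"
      unfolding norm_mult using mask_nonneg[of \<mu> n m \<alpha>] by (simp add: mult_left_mono)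
  qed
  also have "\<dots> = (real n + 1) * norm (z - 1)"
    by (simp only: sum_distrib_right[symmetric] s mult_1)
  finally show ?thesis .
qed

text \<open>
  The points at which the symbols are evaluated approach 1 geometrically, and by the Lipschitz
  bound so do the factors. Individual factors may be 0.
\<close>

lemma convergent_prod_symb:
  assumes n: "n \<ge> 1"
  shows "convergent_prod (\<lambda>k. symb \<mu> n (m + k) (exp (- (\<i> * of_real (\<omega> / 2 ^ (m + k + 1))))))"
    (is "convergent_prod ?A")
proof (intro abs_convergent_prod_imp_convergent_prod summable_imp_abs_convergent_prod)
  have bound: "norm (?A k - 1) \<le> (real n + 1) * (\<bar>\<omega>\<bar> / 2 ^ (m + 1)) * (1 / 2) ^ k" for k
  proof -
    define t where "t = - (\<omega> / 2 ^ (m + k + 1))"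
    have "norm (exp (\<i> * of_real t) - 1) \<le> \<bar>t\<bar>"
      unfolding dist_exp_i_1 using abs_sin_x_le_abs_x[of "t / 2"] by simp
    then have "(real n + 1) * norm (exp (\<i> * of_real t) - 1) \<le> (real n + 1) * \<bar>t\<bar>"
      by (intro mult_left_mono) auto
    moreover have "?A k = symb \<mu> n (m + k) (exp (\<i> * of_real t))" by (simp add: t_def)
    ultimately have "norm (?A k - 1) \<le> (real n + 1) * \<bar>t\<bar>"
      using norm_symb_minus_1_le[OF n, of "exp (\<i> * of_real t)" \<mu> "m + k"] by (metis norm_exp_i_times order.refl order.trans)
    also have "\<bar>t\<bar> = \<bar>\<omega>\<bar> / 2 ^ (m + 1) * (1 / 2) ^ k"
      by (simp add: t_def power_add power_divide abs_mult)
    finally show ?thesis by (simp add: mult_ac)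
  qed
  have "summable (\<lambda>k. (real n + 1) * (\<bar>\<omega>\<bar> / 2 ^ (m + 1)) * (1 / 2) ^ k)"
    by (intro summable_mult summable_geometric) simp
  then show "summable (\<lambda>k. norm (?A k - 1))"
    by (rule summable_comparison_test'[where N = 0]) (simp only: real_norm_def abs_norm_cancel bound)
qed

section \<open>Telescoping the infinite products\<close>

text \<open>
  The quotient of the two partial products is a telescoping product of quotients of box
  transforms. The denominator is kept on the left-hand side, since the transforms and the
  symbols can vanish.
\<close>

lemma partial_prod_symb_Suc:
  fixes \<omega> :: real
  assumes n: "n \<ge> 1"
  defines "z \<equiv> (\<lambda>j. exp (- (\<i> * of_real (\<omega> / 2 ^ (j + 1)))))"
  shows "(\<Prod>k\<le>N. symb \<mu> (Suc n) (m + k) (z (m + k))) * fourier (bspline 0 (m + N + 1)) \<omega> =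
     fourier (bspline 0 (max m 1)) \<omega> * (\<Prod>k\<le>N. symb \<mu> n (m + k) (z (m + k)))"
proof -
  have scale: "(1 + z j) / 2 * fourier (bspline 0 (j + 1)) \<omega> = fourier (bspline 0 j) \<omega>" for j
    unfolding z_def by (rule fourier_box_two_scale[symmetric])
  show ?thesis
  proof (induction N)
    case 0
    show ?case
    \<comment> \<open>At level 0 the symbols agree; otherwise the first factor supplies the box of level \<open>m\<close>.\<close>
    proof (cases "m = 0")
      case False
      then have "max m 1 = m" and m: "m \<ge> 1" by simp_all
      then show ?thesis
        using symb_Suc[OF n m, of \<mu> "z m"] by (simp add: mult_ac del: bspline.simps flip: scale[of m])
    qed (simp add: symb_0 del: bspline.simps)
  next
    case (Suc N)
    have "(\<Prod>k\<le>Suc N. symb \<mu> (Suc n) (m + k) (z (m + k))) * fourier (bspline 0 (m + Suc N + 1)) \<omega> =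
        symb \<mu> n (m + Suc N) (z (m + Suc N)) * ((\<Prod>k\<le>N. symb \<mu> (Suc n) (m + k) (z (m + k))) *
          ((1 + z (m + Suc N)) / 2 * fourier (bspline 0 (m + Suc N + 1)) \<omega>))"
      using symb_Suc[OF n, of "m + Suc N" \<mu> "z (m + Suc N)"] by (simp add: mult_ac del: bspline.simps)
    also have "(1 + z (m + Suc N)) / 2 * fourier (bspline 0 (m + Suc N + 1)) \<omega> =
        fourier (bspline 0 (m + N + 1)) \<omega>"
      using scale[of "m + Suc N"] by (simp del: bspline.simps)
    finally show ?case
      unfolding Suc.IH by (simp add: mult_ac del: bspline.simps)
  qed
qed

lemma prodinf_symb_Suc:
  fixes \<omega> :: real
  assumes n: "n \<ge> 1"
  defines "z \<equiv> (\<lambda>j. exp (- (\<i> * of_real (\<omega> / 2 ^ (j + 1)))))"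
  shows "(\<Prod>k. symb \<mu> (Suc n) (m + k) (z (m + k))) =
     fourier (bspline 0 (max m 1)) \<omega> * (\<Prod>k. symb \<mu> n (m + k) (z (m + k)))"
proof (rule LIMSEQ_unique)
  have conv: "(\<lambda>N. \<Prod>k\<le>N. symb \<mu> j (m + k) (z (m + k))) \<longlonglongrightarrow> (\<Prod>k. symb \<mu> j (m + k) (z (m + k)))"
    if "j \<ge> 1" for j
    unfolding z_def by (intro convergent_prod_LIMSEQ convergent_prod_symb that)
  let ?L = "\<lambda>N. (\<Prod>k\<le>N. symb \<mu> (Suc n) (m + k) (z (m + k))) * fourier (bspline 0 (m + N + 1)) \<omega>"
  have "(\<lambda>N. fourier (bspline 0 (N + (m + 1))) \<omega>) \<longlonglongrightarrow> 1"
    by (rule LIMSEQ_ignore_initial_segment[OF tendsto_fourier_box])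
  then have "(\<lambda>N. fourier (bspline 0 (m + N + 1)) \<omega>) \<longlonglongrightarrow> 1"
    by (simp add: add_ac del: bspline.simps)
  from tendsto_mult[OF conv[of "Suc n"] this]
  show "?L \<longlonglongrightarrow> (\<Prod>k. symb \<mu> (Suc n) (m + k) (z (m + k)))"
    by simp
  have "?L = (\<lambda>N. fourier (bspline 0 (max m 1)) \<omega> * (\<Prod>k\<le>N. symb \<mu> n (m + k) (z (m + k))))"
    unfolding z_def partial_prod_symb_Suc[OF n] ..
  then show "?L \<longlonglongrightarrow> fourier (bspline 0 (max m 1)) \<omega> * (\<Prod>k. symb \<mu> n (m + k) (z (m + k)))"
    using tendsto_mult_left[OF conv[OF n]] by simp
qed

lemma refinable_function_Suc_AE_eq_convol:
  assumes n: "n \<ge> 1"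
    and f: "refinable_function \<mu> (Suc n) m f" and g: "refinable_function \<mu> n m g"
  shows "AE x in lborel. f x = convol (bspline 0 (max m 1)) g x"
proof (rule fourier_eq_imp_AE_eq)
  have g': "integrable lborel g"
    using g by (intro square_integrable_compactly_supported_imp_integrable)
      (auto simp: refinable_function_def)
  show "integrable lborel f"
    using f by (intro square_integrable_compactly_supported_imp_integrable)
      (auto simp: refinable_function_def)
  show "integrable lborel (convol (bspline 0 (max m 1)) g)"
    by (rule integrable_convol[OF integrable_box g'])
  show "fourier f \<omega> = fourier (convol (bspline 0 (max m 1)) g) \<omega>" for \<omega>
    using f g prodinf_symb_Suc[OF n, of \<mu> m \<omega>]
    unfolding fourier_convol[OF integrable_box g'] refinable_function_def by metis
qed

theorem theorem4p1:
  fixes \<mu> :: real and n :: nat and \<phi> :: "nat \<Rightarrow> nat \<Rightarrow> real \<Rightarrow> complex"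
  assumes "\<mu> > 1" and "n \<ge> 3"
    and "\<And>k m. k \<ge> 2 \<Longrightarrow> refinable_function \<mu> k m (\<phi> k m)"
  shows "(AE x in lborel. \<phi> n 0 x = convol (bspline 0 1) (\<phi> (n - 1) 0) x) \<and>
         (\<forall>m>0. AE x in lborel. \<phi> n m x = convol (bspline 0 m) (\<phi> (n - 1) m) x)"
proof -
  have n: "n = Suc (n - 1)" "n - 1 \<ge> 1" "n - 1 \<ge> 2" "n \<ge> 2" using assms(2) by auto
  have *: "AE x in lborel. \<phi> n m x = convol (bspline 0 (max m 1)) (\<phi> (n - 1) m) x" for m
    by (rule refinable_function_Suc_AE_eq_convol[OF n(2)])
      (use assms(3)[OF n(3), of m] assms(3)[OF n(4), of m] n(1) in auto)
  show ?thesis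
  proof (intro conjI allI impI)
    show "AE x in lborel. \<phi> n 0 x = convol (bspline 0 1) (\<phi> (n - 1) 0) x"
      using *[of 0] by (simp only: max_def) (simp del: bspline.simps)
  next
    fix m :: nat assume "m > 0"
    then have "max m 1 = m" by simp
    with *[of m] show "AE x in lborel. \<phi> n m x = convol (bspline 0 m) (\<phi> (n - 1) m) x" by metis
  qed
qed

end
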